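(* Let $\Theta=\{(\mu,\sigma^2,\rho):\ \mu\in\mathbb{R},\ \sigma^2>0,\ 0\le\rho\le 1\}$. For $\theta=(\mu,\sigma^2,\rho)\in\Theta$ let $X_1,X_2,\ldots$ be a sequence of real random variables such that for every $n\in\mathbb{N}$ the vector $(X_1,\ldots,X_n)^T$ has the $n$-variate Gaussian distribution ${\cal N}_n(\boldsymbol{\mu},\boldsymbol{\Sigma})$ with mean vector $\boldsymbol{\mu}=(\mu,\ldots,\mu)^T$ and covariance matrix $\boldsymbol{\Sigma}$ having all diagonal entries equal to $\sigma^2$ and all off-diagonal entries equal to $\rho\sigma^2$. Then $g(\theta)=\rho$ is not empirically identifiable, i.e., there is no sequence of estimators $T_n$ (measurable functions of $(X_1,\ldots,X_n)$) such that for every $\theta=(\mu,\sigma^2,\rho)\in\Theta$, $T_n(X_1,\ldots,X_n)\to\rho$ in probability as $n\to\infty$ when the sequence $(X_i)_{i\in\mathbb{N}}$ has the distribution with parameter $\theta$.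
   Context: Let $X_1,X_2,\ldots$ be random variables on a space ${\cal X}$ whose joint distribution is parameterised by $\theta\in\Theta$; $P_{\infty;\theta}$ denotes the distribution of the whole sequence. Let $g:\Theta\to\Lambda$ with $\Lambda$ a metric space. $g(\theta)$ is called empirically identifiable if there is a sequence of estimators $T_n:{\cal X}^n\to\Lambda$, $n\in\mathbb{N}$, such that for all $\theta\in\Theta$: $T_n(X_1,\ldots,X_n)\to g(\theta)$ in probability under $P_{\infty;\theta}$. Here ${\cal X}=\mathbb{R}$ and $\Lambda=[0,1]$ with the usual metric. *)

theory Defs
  imports "HOL-Probability.Probability"
begin

definition converges_in_probability ::
    "'b measure \<Rightarrow> (nat \<Rightarrow> 'b \<Rightarrow> 'l::metric_space) \<Rightarrow> 'l \<Rightarrow> bool" where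
  "converges_in_probability P Y c \<longleftrightarrow>
     (\<forall>\<epsilon>>0. (\<lambda>n. measure P {x \<in> space P. dist (Y n x) c > \<epsilon>}) \<longlonglongrightarrow> 0)"

text \<open>
  Sequences are indexed from 0, so the coordinates \<open>{..<n}\<close> carry the first \<open>n\<close> observations
  \<open>X\<^sub>1, \<dots>, X\<^sub>n\<close>. The measure \<open>P \<theta>\<close> is the law of the whole sequence, and \<open>S\<close> is the observation
  space. The metric space of parameter values is a subset \<open>\<Lambda>\<close> of a metric type, with the induced
  metric and Borel sets.
\<close>

definition empirically_identifiable ::
    "'x measure \<Rightarrow> 'l::metric_space set \<Rightarrow> 'p set \<Rightarrow> ('p \<Rightarrow> (nat \<Rightarrow> 'x) measure) \<Rightarrow> ('p \<Rightarrow> 'l) \<Rightarrow> bool"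
  where
  "empirically_identifiable S \<Lambda> \<Theta> P g \<longleftrightarrow>
     (\<exists>T. (\<forall>n\<ge>1. T n \<in> measurable (\<Pi>\<^sub>M i\<in>{..<n}. S) (restrict_space borel \<Lambda>)) \<and>
          (\<forall>\<theta>\<in>\<Theta>. converges_in_probability (P \<theta>) (\<lambda>n x. T n (restrict x {..<n})) (g \<theta>)))"

text \<open>
  \<open>N\<close> is the law of \<open>m + A Z\<close> with \<open>Z\<close> a vector of \<open>k\<close> independent standard normal variables and
  \<open>A\<close> an \<open>n \<times> k\<close> matrix with \<open>A A\<^sup>T = C\<close>. A density is not required to exist: the covariance matrix
  \<open>C\<close> may be singular.
\<close>

definition is_multivariate_normal ::
    "nat \<Rightarrow> (nat \<Rightarrow> real) \<Rightarrow> (nat \<Rightarrow> nat \<Rightarrow> real) \<Rightarrow> (nat \<Rightarrow> real) measure \<Rightarrow> bool" where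
  "is_multivariate_normal n m C N \<longleftrightarrow>
     (\<exists>(k::nat) (A :: nat \<Rightarrow> nat \<Rightarrow> real).
        (\<forall>i<n. \<forall>j<n. (\<Sum>l<k. A i l * A j l) = C i j) \<and>
        N = distr (\<Pi>\<^sub>M l\<in>{..<k}. std_normal_distribution) (\<Pi>\<^sub>M i\<in>{..<n}. borel)
              (\<lambda>z. \<lambda>i\<in>{..<n}. m i + (\<Sum>l<k. A i l * z l)))"

text \<open>Parameters are triples \<open>(\<mu>, \<sigma>\<^sup>2, \<rho>)\<close>: the second component is the variance.\<close>

definition equicorrelated_params :: "(real \<times> real \<times> real) set" where
  "equicorrelated_params = {(\<mu>, v, \<rho>). v > 0 \<and> 0 \<le> \<rho> \<and> \<rho> \<le> 1}"

end

theory Submission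
  imports Defs
begin

text \<open>
  If \<open>Z, Z\<^sub>1, Z\<^sub>2, \<dots>\<close> are independent standard normal variables, then \<open>X\<^sub>i = Z + Z\<^sub>i\<close> has the law with
  parameter \<open>(0, 2, 1/2)\<close>, and conditionally on \<open>Z = \<mu>\<close> it has the law with parameter \<open>(\<mu>, 1, 0)\<close>. Estimators
  converging to \<open>0\<close> in probability under every \<open>(\<mu>, 1, 0)\<close> therefore converge to \<open>0\<close> under the mixture
  \<open>(0, 2, 1/2)\<close> by dominated convergence, and so cannot converge to \<open>1/2\<close> there.
\<close>

section \<open>Uniqueness of finite-dimensional laws from characteristic functions\<close>

text \<open>
  The weight is bounded below so that it can be normalised to a probability density, as
  \<open>Levy_uniqueness\<close> only covers probability measures.
\<close>

lemma integral_indicator_eqI_char_pos: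
  fixes f h :: "'b \<Rightarrow> real"
  assumes M: "prob_space M" and N: "prob_space N" and sets: "sets M = sets N"
    and f [measurable]: "f \<in> borel_measurable M" and h [measurable]: "h \<in> borel_measurable M"
    and h_bounds: "\<And>x. 1 \<le> h x" "\<And>x. h x \<le> C"
    and char_eq: "\<And>t. (CLINT x|M. iexp (t * f x) * h x) = (CLINT x|N. iexp (t * f x) * h x)"
    and B: "B \<in> sets borel"
  shows "(LINT x|M. indicator B (f x) * h x) = (LINT x|N. indicator B (f x) * h x)"
proof -
  \<comment> \<open>\<open>D K\<close> is the law of \<open>f\<close> under the normalised weighted
    measure. Its characteristic function is the weighted exponential integral divided by the total
    weight, so the one-dimensional uniqueness theorem applies to it.\<close>
  define D where "D K = distr (density K (\<lambda>x. h x / (LINT x|K. h x))) borel f" for K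
  have D: "real_distribution (D K)" "char (D K) = (\<lambda>t. (CLINT x|K. iexp (t * f x) * h x) / (LINT x|K. h x))"
      "(LINT x|D K. indicator B x) = (LINT x|K. indicator B (f x) * h x) / (LINT x|K. h x)"
      "(LINT x|K. h x) \<ge> 1"
    if K: "prob_space K" and KM: "sets K = sets M" for K
  proof -
    interpret prob_space K by fact
    note KM[measurable_cong]
    have int: "integrable K h"
      using h_bounds by (intro integrable_const_bound[of _ C])
        (auto simp: order_trans[OF zero_le_one h_bounds(1)])
    have "(LINT x|K. 1) \<le> (LINT x|K. h x)"
      using int h_bounds by (intro integral_mono) auto
    then show c: "(LINT x|K. h x) \<ge> 1" by (simp add: prob_space)
    define c where "c = (LINT x|K. h x)"
    have c: "c \<ge> 1" using c by (simp add: c_def)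
    have nn: "0 \<le> h x / c" for x
      using c h_bounds(1)[of x] by auto
    interpret Dens: prob_space "density K (\<lambda>x. h x / c)"
    proof
      have "emeasure (density K (\<lambda>x. h x / c)) (space (density K (\<lambda>x. h x / c))) = (\<integral>\<^sup>+x. ennreal (h x / c) \<partial>K)"
        by (simp add: emeasure_density cong: nn_integral_cong)
      also have "\<dots> = ennreal (LINT x|K. h x / c)"
        using nn int by (intro nn_integral_eq_integral) auto
      also have "(LINT x|K. h x / c) = 1" using c by (simp add: c_def)
      finally show "emeasure (density K (\<lambda>x. h x / c)) (space (density K (\<lambda>x. h x / c))) = 1" by simp
    qed
    show "real_distribution (D K)"
      unfolding D_def c_def[symmetric] by (intro Dens.real_distribution_distr) simp
    show "char (D K) = (\<lambda>t. (CLINT x|K. iexp (t * f x) * h x) / c)"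
      unfolding D_def c_def[symmetric] char_def using nn
      by (auto simp: fun_eq_iff integral_distr integral_density scaleR_conv_of_real mult_ac
               simp flip: integral_divide_zero)
    show "(LINT x|D K. indicator B x) = (LINT x|K. indicator B (f x) * h x) / c"
      unfolding D_def c_def[symmetric] using nn B
      by (subst integral_distr, measurable, subst integral_density)
         (auto simp: mult_ac simp flip: integral_divide_zero)
  qed
  note DM = D[OF M refl] and DN = D[OF N sets[symmetric]]
  \<comment> \<open>At frequency \<open>0\<close> the hypothesis compares the normalising constants
    themselves, so they cancel at the end.\<close>
  have c_eq: "(LINT x|M. h x) = (LINT x|N. h x)"
  proof -
    have "complex_of_real (LINT x|M. h x) = complex_of_real (LINT x|N. h x)"
      using char_eq[of 0] by simp
    then show ?thesis by (simp only: of_real_eq_iff)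
  qed
  have "D M = D N"
    by (intro Levy_uniqueness DM DN) (simp only: DM(2) DN(2) char_eq c_eq)
  then show ?thesis
    using DM(3,4) DN(3) c_eq by auto
qed

text \<open>The weights to be handled later involve \<open>cos\<close> and \<open>sin\<close> and
  change sign. The shifted weight \<open>h + 2\<close> takes values in \<open>[1, 3]\<close>, so the
  positive case covers it; the positive case with constant weight \<open>1\<close> then removes the
  shift. This is why the unweighted equality \<open>char_eq\<close> is assumed as well.\<close>

lemma integral_indicator_eqI_char:
  fixes f h :: "'b \<Rightarrow> real"
  assumes M: "prob_space M" and N: "prob_space N" and sets: "sets M = sets N"
    and f [measurable]: "f \<in> borel_measurable M" and h [measurable]: "h \<in> borel_measurable M"
    and h_bound: "\<And>x. \<bar>h x\<bar> \<le> 1"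
    and char_eq: "\<And>t. (CLINT x|M. iexp (t * f x)) = (CLINT x|N. iexp (t * f x))"
    and weighted_eq: "\<And>t. (CLINT x|M. iexp (t * f x) * h x) = (CLINT x|N. iexp (t * f x) * h x)"
    and B [measurable]: "B \<in> sets borel"
  shows "(LINT x|M. indicator B (f x) * h x) = (LINT x|N. indicator B (f x) * h x)"
proof -
  note sets [measurable_cong, symmetric]
  have split: "(CLINT x|K. iexp (t * f x) * of_real (h x + 2)) =
        (CLINT x|K. iexp (t * f x) * h x) + 2 * (CLINT x|K. iexp (t * f x))"
      "(LINT x|K. indicator B (f x) * (h x + 2)) = (LINT x|K. indicator B (f x) * h x) + 2 * (LINT x|K. indicator B (f x))"
    if K: "prob_space K" and KM: "sets K = sets M" for K t
  proof -
    interpret prob_space K by fact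
    note KM[measurable_cong]
    have 1: "integrable K (\<lambda>x. iexp (t * f x))"
      by (intro integrable_const_bound[of _ 1]) auto
    have 2: "integrable K (\<lambda>x. iexp (t * f x) * h x)"
      using h_bound by (intro integrable_const_bound[of _ 1]) (auto simp: norm_mult)
    have 3: "integrable K (\<lambda>x. indicator B (f x) :: real)"
      by (intro integrable_const_bound[of _ 1]) (auto simp: indicator_def)
    have 4: "integrable K (\<lambda>x. indicator B (f x) * h x)"
      using h_bound by (intro integrable_const_bound[of _ 1]) (auto simp: norm_mult indicator_def)
    show "(CLINT x|K. iexp (t * f x) * of_real (h x + 2)) =
        (CLINT x|K. iexp (t * f x) * h x) + 2 * (CLINT x|K. iexp (t * f x))"
      using 1 2 by (simp add: distrib_left mult.commute[of _ 2] del: of_real_mult)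
    show "(LINT x|K. indicator B (f x) * (h x + 2)) = (LINT x|K. indicator B (f x) * h x) + 2 * (LINT x|K. indicator B (f x))"
      using 3 4 by (simp add: distrib_left mult.commute)
  qed
  have "1 \<le> h x + 2" "h x + 2 \<le> 3" for x using h_bound[of x] by auto
  then have 1: "(LINT x|M. indicator B (f x) * (h x + 2)) = (LINT x|N. indicator B (f x) * (h x + 2))"
    using split(1)[OF M refl] split(1)[OF N sets[symmetric]] char_eq weighted_eq
    by (intro integral_indicator_eqI_char_pos[of _ _ _ _ 3] M N sets B) auto
  have "(LINT x|M. indicator B (f x) * (1::real)) = (LINT x|N. indicator B (f x) * 1)"
    using char_eq by (intro integral_indicator_eqI_char_pos[of _ _ _ _ 1] M N sets B) auto
  with 1 show ?thesis
    using split(2)[OF M refl] split(2)[OF N sets[symmetric]] by simp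
qed

text \<open>Once every coordinate carries an indicator instead of an exponential, the integrals are
  probabilities of boxes, and boxes determine a probability measure on a finite product.
  One-dimensional uniqueness suffices to exchange a single coordinate.\<close>

lemma measure_eqI_PiM_char:
  fixes M N :: "('i \<Rightarrow> real) measure"
  assumes I: "finite I" and M: "prob_space M" and N: "prob_space N"
    and sets_M: "sets M = sets (\<Pi>\<^sub>M i\<in>I. borel)" and sets_N: "sets N = sets (\<Pi>\<^sub>M i\<in>I. borel)"
    and char_eq: "\<And>t. (CLINT x|M. iexp (\<Sum>i\<in>I. t i * x i)) = (CLINT x|N. iexp (\<Sum>i\<in>I. t i * x i))"
  shows "M = N"
proof -
  note sets_M[measurable_cong] sets_N[measurable_cong]
  have sets: "sets M = sets N" using sets_M sets_N by simp
  \<comment> \<open>The coordinates are converted one at a time from exponentials to indicators. The remaining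
     exponential is a complex weight, split into its bounded real parts \<open>cos\<close> and \<open>sin\<close>; these are
     combinations of that exponential and the one with all its frequencies negated.\<close>
  have step: "(CLINT x|M. (\<Prod>j\<in>J. indicator (B j) (x j)) * iexp (\<Sum>i\<in>I-J. t i * x i)) =
      (CLINT x|N. (\<Prod>j\<in>J. indicator (B j) (x j)) * iexp (\<Sum>i\<in>I-J. t i * x i))"
    if "finite J" "J \<subseteq> I" and B: "\<And>j. j \<in> J \<Longrightarrow> B j \<in> sets borel" for J B t
    using that
  proof (induction J arbitrary: t rule: finite_induct)
    case empty
    then show ?case using char_eq[of t] by simp
  next
    case (insert k J)
    define w :: "('i \<Rightarrow> real) \<Rightarrow> real" where "w x = (\<Prod>j\<in>J. indicator (B j) (x j))" for x
    define s where "s x = (\<Sum>i\<in>I-insert k J. t i * x i)" for x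
    have k: "k \<in> I" and Bk [measurable]: "B k \<in> sets borel" and BJ: "\<And>j. j \<in> J \<Longrightarrow> B j \<in> sets borel"
      using insert.prems by auto
    have w_bounds: "0 \<le> w x" "w x \<le> 1" for x
      by (auto simp: w_def indicator_def intro!: prod_nonneg prod_le_1)
    have w_meas: "w \<in> borel_measurable (\<Pi>\<^sub>M i\<in>I. borel)"
      unfolding w_def using insert.prems
      by (intro borel_measurable_prod borel_measurable_indicator' measurable_component_singleton) auto
    have s_meas: "s \<in> borel_measurable (\<Pi>\<^sub>M i\<in>I. borel)"
      unfolding s_def by (intro borel_measurable_sum borel_measurable_times measurable_component_singleton) auto
    have k_meas: "(\<lambda>x. x k) \<in> borel_measurable (\<Pi>\<^sub>M i\<in>I. borel)"
      using k by (intro measurable_component_singleton)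
    note [measurable] = w_meas s_meas k_meas
    \<comment> \<open>Coordinate \<open>k\<close> is split off from \<open>I - J\<close> with a free
      frequency \<open>u\<close>, which supplies the whole characteristic function in that
      coordinate. The factor \<open>e\<close> is later \<open>1\<close> or \<open>-1\<close>, giving
      the two exponentials that make up \<open>cos\<close> and \<open>sin\<close>.\<close>
    have IH: "(CLINT x|M. w x * iexp (u * x k + e * s x)) = (CLINT x|N. w x * iexp (u * x k + e * s x))" for u e
    proof -
      have "(\<Sum>i\<in>I-J. ((\<lambda>i. e * t i)(k := u)) i * x i) = u * x k + e * s x" for x
      proof -
        have split: "I - J = insert k (I - insert k J)" using k insert.hyps by auto
        have "(\<Sum>i\<in>I-J. ((\<lambda>i. e * t i)(k := u)) i * x i) =
            u * x k + (\<Sum>i\<in>I-insert k J. ((\<lambda>i. e * t i)(k := u)) i * x i)"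
          unfolding split using I by (subst sum.insert) auto
        also have "(\<Sum>i\<in>I-insert k J. ((\<lambda>i. e * t i)(k := u)) i * x i) =
            (\<Sum>i\<in>I-insert k J. e * (t i * x i))"
          by (intro sum.cong) auto
        finally show ?thesis by (simp only: s_def sum_distrib_left)
      qed
      then show ?thesis
        using insert.IH[OF _ BJ, of "(\<lambda>i. e * t i)(k := u)"] insert.prems(1)
        by (simp only: w_def of_real_prod of_real_indicator insert_subset)
    qed
    \<comment> \<open>Stated for a generic \<open>K\<close> in order to serve both \<open>M\<close>
      and \<open>N\<close>. The first two identities reduce the weighted transforms to
      \<open>IH\<close>; the third reassembles the complex integral by Euler's formula after the
      indicator of \<open>B k\<close> has been introduced.\<close>
    have weighted: "(CLINT x|K. iexp (u * x k) * (w x * cos (s x))) =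
        ((CLINT x|K. w x * iexp (u * x k + 1 * s x)) + (CLINT x|K. w x * iexp (u * x k + (-1) * s x))) / 2"
        "(CLINT x|K. iexp (u * x k) * (w x * sin (s x))) =
        ((CLINT x|K. w x * iexp (u * x k + 1 * s x)) - (CLINT x|K. w x * iexp (u * x k + (-1) * s x))) / (2 * \<i>)"
        "(CLINT x|K. (\<Prod>j\<in>insert k J. indicator (B j) (x j)) * iexp (\<Sum>i\<in>I-insert k J. t i * x i)) =
         complex_of_real (LINT x|K. indicator (B k) (x k) * (w x * cos (s x))) +
         \<i> * complex_of_real (LINT x|K. indicator (B k) (x k) * (w x * sin (s x)))"
      if K: "prob_space K" and KM: "sets K = sets M" for K u
    proof -
      interpret prob_space K by fact
      note KM[measurable_cong]
      have int: "integrable K (\<lambda>x. w x * iexp (u * x k + e * s x))" for e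
        using w_bounds by (intro integrable_const_bound[of _ 1]) (auto simp: norm_mult)
      have cos: "iexp (u * x k) * (w x * cos (s x)) =
          (w x * iexp (u * x k + 1 * s x) + w x * iexp (u * x k + (-1) * s x)) / 2"
       and sin: "iexp (u * x k) * (w x * sin (s x)) =
          (w x * iexp (u * x k + 1 * s x) - w x * iexp (u * x k + (-1) * s x)) / (2 * \<i>)" for x
        by (auto simp: cos_exp_eq sin_exp_eq distrib_left exp_add exp_diff exp_minus field_simps
              simp flip: cos_of_real sin_of_real)
      show "(CLINT x|K. iexp (u * x k) * (w x * cos (s x))) =
        ((CLINT x|K. w x * iexp (u * x k + 1 * s x)) + (CLINT x|K. w x * iexp (u * x k + (-1) * s x))) / 2"
        unfolding cos by (simp only: integral_divide_zero Bochner_Integration.integral_add[OF int int])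
      show "(CLINT x|K. iexp (u * x k) * (w x * sin (s x))) =
        ((CLINT x|K. w x * iexp (u * x k + 1 * s x)) - (CLINT x|K. w x * iexp (u * x k + (-1) * s x))) / (2 * \<i>)"
        unfolding sin by (simp only: integral_divide_zero Bochner_Integration.integral_diff[OF int int])
      have bnd: "\<bar>w x * c\<bar> \<le> 1" if "\<bar>c\<bar> \<le> 1" for x c
        using w_bounds[of x] that by (simp add: abs_mult mult_le_one)
      have c: "integrable K (\<lambda>x. indicator (B k) (x k) * (w x * cos (s x)))"
        and s: "integrable K (\<lambda>x. indicator (B k) (x k) * (w x * sin (s x)))"
        using bnd by (auto intro!: integrable_const_bound[of _ 1] simp: indicator_def)
      have "(\<Prod>j\<in>insert k J. indicator (B j) (x j)) * iexp (\<Sum>i\<in>I-insert k J. t i * x i) =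
         complex_of_real (indicator (B k) (x k) * (w x * cos (s x))) +
         \<i> * complex_of_real (indicator (B k) (x k) * (w x * sin (s x)))" for x
        using insert.hyps
        by (simp add: w_def s_def[symmetric] exp_Euler cos_of_real sin_of_real distrib_left mult_ac of_real_indicator)
      then show "(CLINT x|K. (\<Prod>j\<in>insert k J. indicator (B j) (x j)) * iexp (\<Sum>i\<in>I-insert k J. t i * x i)) =
         complex_of_real (LINT x|K. indicator (B k) (x k) * (w x * cos (s x))) +
         \<i> * complex_of_real (LINT x|K. indicator (B k) (x k) * (w x * sin (s x)))"
        using c s by (simp del: of_real_mult)
    qed
    \<comment> \<open>The unweighted one-dimensional hypothesis: all frequencies except that of
      \<open>k\<close> are set to \<open>0\<close>.\<close>
    have char_k: "(CLINT x|M. iexp (u * x k)) = (CLINT x|N. iexp (u * x k))" for u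
    proof -
      have "(\<Sum>i\<in>I. ((\<lambda>_. 0)(k := u)) i * x i) = u * x k" for x :: "'i \<Rightarrow> real"
        using I k by (subst sum.remove[of _ k]) auto
      then show ?thesis using char_eq[of "(\<lambda>_. 0)(k := u)"] by simp
    qed
    have bnd: "\<bar>w x * c\<bar> \<le> 1" if "\<bar>c\<bar> \<le> 1" for x c
      using w_bounds[of x] that by (simp add: abs_mult mult_le_one)
    have wc: "(CLINT x|M. iexp (u * x k) * (w x * cos (s x))) = (CLINT x|N. iexp (u * x k) * (w x * cos (s x)))"
      and ws: "(CLINT x|M. iexp (u * x k) * (w x * sin (s x))) = (CLINT x|N. iexp (u * x k) * (w x * sin (s x)))" for u
      by (simp_all only: weighted(1,2)[OF M refl] weighted(1,2)[OF N sets[symmetric]] IH)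
    have "(LINT x|M. indicator (B k) (x k) * (w x * cos (s x))) =
        (LINT x|N. indicator (B k) (x k) * (w x * cos (s x)))"
      by (intro integral_indicator_eqI_char[OF M N sets _ _ _ char_k _ Bk] wc bnd) auto
    moreover have "(LINT x|M. indicator (B k) (x k) * (w x * sin (s x))) =
        (LINT x|N. indicator (B k) (x k) * (w x * sin (s x)))"
      by (intro integral_indicator_eqI_char[OF M N sets _ _ _ char_k _ Bk] ws bnd) auto
    ultimately show ?case by (simp only: weighted(3)[OF M refl] weighted(3)[OF N sets[symmetric]])
  qed
  interpret M: prob_space M by fact
  interpret N: prob_space N by fact
  show ?thesis
  \<comment> \<open>The rule asks for a countable cover by boxes of finite measure; for probability
    measures the constant sequence of the full space will do.\<close>
  proof (rule measure_eqI_PiM_finite[OF I sets_M sets_N, where A="\<lambda>_. Pi\<^sub>E I (\<lambda>_. UNIV)"])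
    fix A :: "'i \<Rightarrow> real set" assume A: "\<And>i. i \<in> I \<Longrightarrow> A i \<in> sets borel"
    then have box: "Pi\<^sub>E I A \<in> sets (\<Pi>\<^sub>M i\<in>I. borel)"
      using I by (intro sets_PiM_I_finite) auto
    \<comment> \<open>This is the case \<open>J = I\<close> of \<open>step\<close>: the remaining
      sum is empty and the exponential equals \<open>1\<close>.\<close>
    have "(CLINT x|K. (\<Prod>j\<in>I. indicator (A j) (x j)) * iexp (\<Sum>i\<in>I-I. t i * x i)) = measure K (Pi\<^sub>E I A)"
      if K: "prob_space K" and KM: "sets K = sets (\<Pi>\<^sub>M i\<in>I. borel)" for K and t :: "'i \<Rightarrow> real"
    proof -
      interpret prob_space K by fact
      have sp: "space K = Pi\<^sub>E I (\<lambda>_. UNIV)" using sets_eq_imp_space_eq[OF KM] by (simp add: space_PiM)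
      have "(\<Prod>j\<in>I. indicator (A j) (x j)) = complex_of_real (indicator (Pi\<^sub>E I A) x)" if "x \<in> space K" for x
        using that I by (auto simp: sp indicator_def PiE_iff prod_zero_iff)
      then have "(CLINT x|K. (\<Prod>j\<in>I. indicator (A j) (x j)) * iexp (\<Sum>i\<in>I-I. t i * x i)) =
          (CLINT x|K. complex_of_real (indicator (Pi\<^sub>E I A) x))"
        by (intro Bochner_Integration.integral_cong) auto
      also have "\<dots> = measure K (Pi\<^sub>E I A)"
        using box KM by (simp del: of_real_indicator)
      finally show ?thesis .
    qed
    from this[OF M sets_M] this[OF N sets_N] step[OF I subset_refl A, where t="\<lambda>_. 0"]
    show "emeasure M (Pi\<^sub>E I A) = emeasure N (Pi\<^sub>E I A)"
      by (simp add: M.emeasure_eq_measure N.emeasure_eq_measure)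
  qed (auto simp: space_PiM intro!: prod_algebraI_finite[OF I])
qed

section \<open>Gaussian vectors, possibly with singular covariance\<close>

text \<open>A linear combination of the coordinates is a constant plus a combination of independent
  standard normals, so the transform factorises. The point is that \<open>k\<close> and
  \<open>A\<close> disappear from the result.\<close>

lemma char_multivariate_normal:
  assumes "is_multivariate_normal n m C N"
  shows "prob_space N" "sets N = sets (\<Pi>\<^sub>M i\<in>{..<n}. borel)"
    "(CLINT x|N. iexp (\<Sum>i<n. t i * x i)) =
       iexp (\<Sum>i<n. t i * m i) * exp (- (\<Sum>i<n. \<Sum>j<n. t i * t j * C i j) / 2)"
proof -
  obtain k :: nat and A :: "nat \<Rightarrow> nat \<Rightarrow> real" where A: "\<forall>i<n. \<forall>j<n. (\<Sum>l<k. A i l * A j l) = C i j"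
    and N: "N = distr (\<Pi>\<^sub>M l\<in>{..<k}. std_normal_distribution) (\<Pi>\<^sub>M i\<in>{..<n}. borel)
              (\<lambda>z. \<lambda>i\<in>{..<n}. m i + (\<Sum>l<k. A i l * z l))"
    using assms unfolding is_multivariate_normal_def by blast
  interpret Z: prob_space std_normal_distribution
    by (rule prob_space_normal_density) simp
  interpret product_prob_space "\<lambda>_. std_normal_distribution" "{..<k}" ..
  \<comment> \<open>In matrix form \<open>s\<close> is \<open>A\<close> transposed applied to
    \<open>t\<close>, so its squared length is the quadratic form of \<open>C\<close> at
    \<open>t\<close>; this is \<open>quad\<close>.\<close>
  define s where "s l = (\<Sum>i<n. t i * A i l)" for l
  have [measurable]: "(\<lambda>z. \<lambda>i\<in>{..<n}. m i + (\<Sum>l<k. A i l * z l)) \<in>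
      measurable (\<Pi>\<^sub>M l\<in>{..<k}. std_normal_distribution) (\<Pi>\<^sub>M i\<in>{..<n}. borel)"
    by measurable
  have [measurable]: "(\<lambda>x. iexp (\<Sum>i<n. t i * x i)) \<in> borel_measurable (\<Pi>\<^sub>M i\<in>{..<n}. borel)"
    by measurable
  show "prob_space N" unfolding N by (intro P.prob_space_distr) measurable
  show "sets N = sets (\<Pi>\<^sub>M i\<in>{..<n}. borel)" unfolding N by simp
  have lin: "(\<Sum>i<n. t i * (m i + (\<Sum>l<k. A i l * z l))) = (\<Sum>i<n. t i * m i) + (\<Sum>l<k. s l * z l)" for z
    by (simp add: s_def distrib_left sum.distrib sum_distrib_left sum_distrib_right mult_ac
        sum.swap[of _ "{..<k}"])
  have quad: "(\<Sum>l<k. (s l)\<^sup>2) = (\<Sum>i<n. \<Sum>j<n. t i * t j * C i j)"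
  proof -
    have "(\<Sum>l<k. (s l)\<^sup>2) = (\<Sum>l<k. \<Sum>i<n. \<Sum>j<n. t i * t j * (A i l * A j l))"
      by (simp add: s_def power2_eq_square sum_product mult_ac)
    also have "\<dots> = (\<Sum>i<n. \<Sum>j<n. \<Sum>l<k. t i * t j * (A i l * A j l))"
      by (subst sum.swap) (intro sum.cong refl sum.swap)
    also have "\<dots> = (\<Sum>i<n. \<Sum>j<n. t i * t j * C i j)"
      by (intro sum.cong refl) (simp add: A flip: sum_distrib_left)
    finally show ?thesis .
  qed
  have "(CLINT x|N. iexp (\<Sum>i<n. t i * x i)) =
     (CLINT z|(\<Pi>\<^sub>M l\<in>{..<k}. std_normal_distribution). iexp (\<Sum>i<n. t i * (m i + (\<Sum>l<k. A i l * z l))))"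
    unfolding N by (subst integral_distr) auto
  also have "\<dots> = (CLINT z|(\<Pi>\<^sub>M l\<in>{..<k}. std_normal_distribution).
      iexp (\<Sum>i<n. t i * m i) * (\<Prod>l<k. iexp (s l * z l)))"
    by (simp only: lin) (simp add: distrib_left exp_add sum_distrib_left exp_sum)
  also have "\<dots> = iexp (\<Sum>i<n. t i * m i) * (\<Prod>l<k. char std_normal_distribution (s l))"
    unfolding char_def
    by (subst integral_mult_right_zero, subst product_integral_prod)
       (auto intro!: Z.integrable_const_bound[of _ 1])
  also have "(\<Prod>l<k. char std_normal_distribution (s l)) = exp (- (\<Sum>l<k. (s l)\<^sup>2) / 2)"
    by (simp add: char_std_normal_distribution sum_divide_distrib exp_sum flip: sum_negf exp_of_real)
  finally show "(CLINT x|N. iexp (\<Sum>i<n. t i * x i)) =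
       iexp (\<Sum>i<n. t i * m i) * exp (- (\<Sum>i<n. \<Sum>j<n. t i * t j * C i j) / 2)"
    by (simp add: quad)
qed

text \<open>Different factorisations of the same covariance yield the same law, since the
  characteristic function sees only \<open>m\<close> and \<open>C\<close>. This allows the given
  observations to be replaced by explicit models.\<close>

lemma multivariate_normal_unique:
  assumes "is_multivariate_normal n m C N" "is_multivariate_normal n m C N'"
  shows "N = N'"
  using char_multivariate_normal[OF assms(1)] char_multivariate_normal[OF assms(2)]
  by (intro measure_eqI_PiM_char[of "{..<n}"]) simp_all

section \<open>The explicit models: independent observations and a common random shift\<close>

lemma sum_of_bool_eq_mult:
  fixes z :: "nat \<Rightarrow> real"
  shows "i < n \<Longrightarrow> (\<Sum>l<n. of_bool (l = i) * z l) = z i"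
  by (subst sum.remove[of _ i]) (auto intro!: sum.neutral)

text \<open>The factor \<open>A\<close> is the identity matrix. The entry \<open>0 * 1\<close> keeps
  the shape \<open>\<rho> * v\<close> at \<open>\<rho> = 0\<close>, \<open>v = 1\<close>.\<close>

lemma multivariate_normal_iid:
  "is_multivariate_normal n (\<lambda>i. \<mu>) (\<lambda>i j. if i = j then 1 else 0 * 1)
     (distr (\<Pi>\<^sub>M l\<in>{..<n}. std_normal_distribution) (\<Pi>\<^sub>M i\<in>{..<n}. borel) (\<lambda>z. \<lambda>i\<in>{..<n}. \<mu> + z i))"
  unfolding is_multivariate_normal_def
proof (rule exI[of _ n], rule exI[of _ "\<lambda>i l. of_bool (l = i)"],
    intro conjI allI impI)
  fix i j assume "i < n" "j < n"
  then show "(\<Sum>l<n. of_bool (l = i) * of_bool (l = j)) = (if i = j then 1 else 0 * 1 :: real)"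
    by (subst sum_of_bool_eq_mult) auto
next
  have "(\<lambda>i\<in>{..<n}. \<mu> + z i) = (\<lambda>i\<in>{..<n}. \<mu> + (\<Sum>l<n. of_bool (l = i) * z l))" for z
    by (intro restrict_ext) (simp add: sum_of_bool_eq_mult)
  then show "distr (\<Pi>\<^sub>M l\<in>{..<n}. std_normal_distribution) (\<Pi>\<^sub>M i\<in>{..<n}. borel) (\<lambda>z. \<lambda>i\<in>{..<n}. \<mu> + z i) =
      distr (\<Pi>\<^sub>M l\<in>{..<n}. std_normal_distribution) (\<Pi>\<^sub>M i\<in>{..<n}. borel)
        (\<lambda>z. \<lambda>i\<in>{..<n}. \<mu> + (\<Sum>l<n. of_bool (l = i) * z l))"
    by (simp only:)
qed

text \<open>The factor \<open>A\<close> is the identity with a column of ones appended. The common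
  shift sits at the last index \<open>n\<close>, so that it can be split off from the first
  \<open>n\<close> coordinates by Fubini.\<close>

lemma multivariate_normal_common_factor:
  "is_multivariate_normal n (\<lambda>i. 0) (\<lambda>i j. if i = j then 2 else 1 / 2 * 2)
     (distr (\<Pi>\<^sub>M l\<in>{..<Suc n}. std_normal_distribution) (\<Pi>\<^sub>M i\<in>{..<n}. borel) (\<lambda>z. \<lambda>i\<in>{..<n}. z n + z i))"
  unfolding is_multivariate_normal_def
proof (rule exI[of _ "Suc n"], rule exI[of _ "\<lambda>i l. of_bool (l = n) + of_bool (l = i)"],
    intro conjI allI impI)
  fix i j assume "i < n" "j < n"
  then show "(\<Sum>l<Suc n. (of_bool (l = n) + of_bool (l = i)) * (of_bool (l = n) + of_bool (l = j))) =
      (if i = j then 2 else 1 / 2 * 2 :: real)"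
    by (simp only: distrib_right sum.distrib sum_of_bool_eq_mult less_Suc_eq) auto
next
  have "(\<lambda>i\<in>{..<n}. z n + z i) = (\<lambda>i\<in>{..<n}. 0 + (\<Sum>l<Suc n. (of_bool (l = n) + of_bool (l = i)) * z l))"
    for z :: "nat \<Rightarrow> real"
    by (intro restrict_ext) (simp only: distrib_right sum.distrib sum_of_bool_eq_mult less_Suc_eq lessThan_iff simp_thms add_0)
  then show "distr (\<Pi>\<^sub>M l\<in>{..<Suc n}. std_normal_distribution) (\<Pi>\<^sub>M i\<in>{..<n}. borel) (\<lambda>z. \<lambda>i\<in>{..<n}. z n + z i) =
      distr (\<Pi>\<^sub>M l\<in>{..<Suc n}. std_normal_distribution) (\<Pi>\<^sub>M i\<in>{..<n}. borel)
        (\<lambda>z. \<lambda>i\<in>{..<n}. 0 + (\<Sum>l<Suc n. (of_bool (l = n) + of_bool (l = i)) * z l))"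
    by (simp only:)
qed

section \<open>Failure of empirical identifiability\<close>

theorem theorem3p3:
  fixes M :: "real \<times> real \<times> real \<Rightarrow> 'a measure"
    and X :: "real \<times> real \<times> real \<Rightarrow> nat \<Rightarrow> 'a \<Rightarrow> real"
  assumes "\<And>\<theta>. \<theta> \<in> equicorrelated_params \<Longrightarrow> prob_space (M \<theta>)"
    and "\<And>\<theta> i. \<theta> \<in> equicorrelated_params \<Longrightarrow> X \<theta> i \<in> borel_measurable (M \<theta>)"
    and "\<And>\<mu> v \<rho> n. (\<mu>, v, \<rho>) \<in> equicorrelated_params \<Longrightarrow> n \<ge> 1 \<Longrightarrow>
           is_multivariate_normal n (\<lambda>i. \<mu>) (\<lambda>i j. if i = j then v else \<rho> * v)
             (distr (M (\<mu>, v, \<rho>)) (\<Pi>\<^sub>M i\<in>{..<n}. borel) (\<lambda>\<omega>. \<lambda>i\<in>{..<n}. X (\<mu>, v, \<rho>) i \<omega>))"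
  shows "\<not> empirically_identifiable borel {0..1} equicorrelated_params
           (\<lambda>\<theta>. distr (M \<theta>) (\<Pi>\<^sub>M i\<in>UNIV. borel) (\<lambda>\<omega> i. X \<theta> i \<omega>))
           (\<lambda>(\<mu>, v, \<rho>). \<rho>)"
proof
  let ?Z = "\<lambda>n. \<Pi>\<^sub>M l\<in>{..<n::nat}. std_normal_distribution"
  let ?K = "\<lambda>n. \<Pi>\<^sub>M i\<in>{..<n::nat}. borel :: real measure"
  assume "empirically_identifiable borel {0..1} equicorrelated_params
           (\<lambda>\<theta>. distr (M \<theta>) (\<Pi>\<^sub>M i\<in>UNIV. borel) (\<lambda>\<omega> i. X \<theta> i \<omega>))
           (\<lambda>(\<mu>, v, \<rho>). \<rho>)"
  then obtain T :: "nat \<Rightarrow> (nat \<Rightarrow> real) \<Rightarrow> real"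
    where T: "\<And>n. n \<ge> 1 \<Longrightarrow> T n \<in> measurable (?K n) (restrict_space borel {0..1})"
      and conv: "\<And>\<theta>. \<theta> \<in> equicorrelated_params \<Longrightarrow>
        converges_in_probability (distr (M \<theta>) (\<Pi>\<^sub>M i\<in>UNIV. borel) (\<lambda>\<omega> i. X \<theta> i \<omega>))
          (\<lambda>n x. T n (restrict x {..<n})) (case \<theta> of (\<mu>, v, \<rho>) \<Rightarrow> \<rho>)"
    unfolding empirically_identifiable_def by blast
  \<comment> \<open>Any positive radius below \<open>1/4\<close>, half the distance from
    \<open>0\<close> to \<open>1/2\<close>, would do: no estimate can then be close to both
    values.\<close>
  define E where "E n c = {y \<in> space (?K n). dist (T n y) c > 1/5}" for n c
  have T_borel [measurable]: "T n \<in> borel_measurable (?K n)" if "n \<ge> 1" for n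
    using T[OF that] by (simp add: measurable_restrict_space2_iff)
  have E_sets [measurable]: "E n c \<in> sets (?K n)" if "n \<ge> 1" for n c
    unfolding E_def using T_borel[OF that] by measurable
  \<comment> \<open>Consistency is transferred from the observed sequence to any family
    \<open>L\<close> of Gaussian laws with the same means and covariances. The events depend only on
    the first \<open>n\<close> coordinates, whose law is unique.\<close>
  have lim: "(\<lambda>n. measure (L n) (E n \<rho>)) \<longlonglongrightarrow> 0"
    if \<theta>: "(\<mu>, v, \<rho>) \<in> equicorrelated_params"
      and L: "\<And>n. is_multivariate_normal n (\<lambda>i. \<mu>) (\<lambda>i j. if i = j then v else \<rho> * v) (L n)" for \<mu> v \<rho> L
  proof (rule Lim_transform_eventually)
    let ?P = "distr (M (\<mu>, v, \<rho>)) (\<Pi>\<^sub>M i\<in>UNIV. borel) (\<lambda>\<omega> i. X (\<mu>, v, \<rho>) i \<omega>)"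
    show "(\<lambda>n. measure ?P {x \<in> space ?P. dist (T n (restrict x {..<n})) \<rho> > 1/5}) \<longlonglongrightarrow> 0"
      using conv[OF \<theta>, unfolded converges_in_probability_def, rule_format, of "1/5"]
      by (simp only: prod.case)
    have "measure ?P {x \<in> space ?P. dist (T n (restrict x {..<n})) \<rho> > 1/5} = measure (L n) (E n \<rho>)"
      if n: "n \<ge> 1" for n
    proof -
      have [measurable]: "(\<lambda>\<omega> i. X (\<mu>, v, \<rho>) i \<omega>) \<in> measurable (M (\<mu>, v, \<rho>)) (\<Pi>\<^sub>M i\<in>UNIV. borel)"
        using assms(2)[OF \<theta>] by (intro measurable_PiM_single') auto
      note [measurable] = E_sets[OF n]
      have pre: "{x \<in> space ?P. dist (T n (restrict x {..<n})) \<rho> > 1/5} =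
          (\<lambda>x. restrict x {..<n}) -` E n \<rho> \<inter> space (\<Pi>\<^sub>M i\<in>UNIV. borel)"
        by (auto simp: E_def space_PiM)
      have "(\<lambda>x. restrict x {..<n}) \<in> measurable (\<Pi>\<^sub>M i\<in>UNIV. borel) (?K n)"
        by measurable
      then have "measure ?P {x \<in> space ?P. dist (T n (restrict x {..<n})) \<rho> > 1/5} =
          measure (distr ?P (?K n) (\<lambda>x. restrict x {..<n})) (E n \<rho>)"
        unfolding pre by (subst measure_distr) auto
      also have "distr ?P (?K n) (\<lambda>x. restrict x {..<n}) =
          distr (M (\<mu>, v, \<rho>)) (?K n) (\<lambda>\<omega>. \<lambda>i\<in>{..<n}. X (\<mu>, v, \<rho>) i \<omega>)"
        by (subst distr_distr) (auto simp: comp_def)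
      also have "\<dots> = L n"
        by (rule multivariate_normal_unique[OF assms(3)[OF \<theta> n] L])
      finally show ?thesis .
    qed
    then show "\<forall>\<^sub>F n in sequentially.
        measure ?P {x \<in> space ?P. dist (T n (restrict x {..<n})) \<rho> > 1/5} = measure (L n) (E n \<rho>)"
      by (auto simp: eventually_sequentially)
  qed
  define R where "R n = distr (?Z (Suc n)) (?K n) (\<lambda>z. \<lambda>i\<in>{..<n}. z n + z i)" for n
  define Q where "Q n \<mu> = distr (?Z n) (?K n) (\<lambda>z. \<lambda>i\<in>{..<n}. \<mu> + z i)" for n \<mu>
  have R: "is_multivariate_normal n (\<lambda>i. 0) (\<lambda>i j. if i = j then 2 else 1 / 2 * 2) (R n)" for n
    unfolding R_def by (rule multivariate_normal_common_factor)
  have Q: "is_multivariate_normal n (\<lambda>i. \<mu>) (\<lambda>i j. if i = j then 1 else 0 * 1) (Q n \<mu>)" for n \<mu>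
    unfolding Q_def by (rule multivariate_normal_iid)
  have R_lim: "(\<lambda>n. measure (R n) (E n (1/2))) \<longlonglongrightarrow> 0"
    by (rule lim[OF _ R]) (simp add: equicorrelated_params_def)
  have Q_lim: "(\<lambda>n. measure (Q n \<mu>) (E n 0)) \<longlonglongrightarrow> 0" for \<mu>
    by (rule lim[OF _ Q]) (simp add: equicorrelated_params_def)
  interpret Z: prob_space std_normal_distribution
    by (rule prob_space_normal_density) simp
  interpret product_sigma_finite "\<lambda>_. std_normal_distribution" ..
  have prob: "prob_space (R n)" "prob_space (Q n \<mu>)" for n \<mu>
    using char_multivariate_normal(1)[OF R] char_multivariate_normal(1)[OF Q] by auto
  interpret R: prob_space "R n" for n by (rule prob)
  \<comment> \<open>Writing the probability as an integral over \<open>z\<close> with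
    \<open>\<mu>\<close> inside the integrand gives measurability in \<open>\<mu>\<close> and
    matches the inner integral in \<open>mixture\<close>.\<close>
  have Q_alt: "emeasure (Q n \<mu>) (E n 0) = (\<integral>\<^sup>+z. indicator (E n 0) (\<lambda>i\<in>{..<n}. \<mu> + z i) \<partial>?Z n)"
    if n: "n \<ge> 1" for n \<mu>
    unfolding Q_def using E_sets[OF n]
    by (simp add: nn_integral_distr flip: nn_integral_indicator)
  have Q_meas: "(\<lambda>\<mu>. emeasure (Q n \<mu>) (E n 0)) \<in> borel_measurable std_normal_distribution" if n: "n \<ge> 1" for n
  proof -
    interpret Zn: prob_space "?Z n" by (intro prob_space_PiM Z.prob_space_axioms)
    note [measurable] = E_sets[OF n]
    show ?thesis
      unfolding Q_alt[OF n] by measurable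
  qed
  have mixture: "emeasure (R n) (E n 0) = (\<integral>\<^sup>+\<mu>. emeasure (Q n \<mu>) (E n 0) \<partial>std_normal_distribution)"
    if n: "n \<ge> 1" for n
  proof -
    note [measurable] = E_sets[OF n]
    have "emeasure (R n) (E n 0) = (\<integral>\<^sup>+z. indicator (E n 0) (\<lambda>i\<in>{..<n}. z n + z i) \<partial>?Z (Suc n))"
      unfolding R_def by (simp add: nn_integral_distr flip: nn_integral_indicator)
    also have "\<dots> = (\<integral>\<^sup>+z. indicator (E n 0) (\<lambda>i\<in>{..<n}. z n + z i) \<partial>(\<Pi>\<^sub>M l\<in>insert n {..<n}. std_normal_distribution))"
      by (simp only: lessThan_Suc)
    \<comment> \<open>Fubini with the shift, coordinate \<open>n\<close>, integrated outermost.
      Updating \<open>z\<close> at \<open>n\<close> leaves the entries below \<open>n\<close>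
      unchanged, so the inner integral is a probability under \<open>Q n \<mu>\<close>.\<close>
    also have "\<dots> = (\<integral>\<^sup>+\<mu>. \<integral>\<^sup>+z. indicator (E n 0) (\<lambda>i\<in>{..<n}. (z(n := \<mu>)) n + (z(n := \<mu>)) i) \<partial>?Z n \<partial>std_normal_distribution)"
      by (rule product_nn_integral_insert_rev) auto
    also have "\<dots> = (\<integral>\<^sup>+\<mu>. emeasure (Q n \<mu>) (E n 0) \<partial>std_normal_distribution)"
      unfolding Q_alt[OF n]
      by (intro nn_integral_cong arg_cong[where f="indicator _"] restrict_ext) auto
    finally show ?thesis .
  qed
  \<comment> \<open>The index is \<open>Suc n\<close> because measurability of the estimators, and
    hence of the events, is available only from sample size \<open>1\<close> on.\<close>
  have "(\<lambda>n. \<integral>\<^sup>+\<mu>. emeasure (Q (Suc n) \<mu>) (E (Suc n) 0) \<partial>std_normal_distribution)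
      \<longlonglongrightarrow> (\<integral>\<^sup>+\<mu>. 0 \<partial>std_normal_distribution)"
  proof (rule nn_integral_dominated_convergence[where w="\<lambda>_. 1"])
    show "AE \<mu> in std_normal_distribution. emeasure (Q (Suc n) \<mu>) (E (Suc n) 0) \<le> 1" for n
      using prob(2) by (auto intro!: AE_I2 prob_space.emeasure_le_1)
    show "AE \<mu> in std_normal_distribution. (\<lambda>n. emeasure (Q (Suc n) \<mu>) (E (Suc n) 0)) \<longlonglongrightarrow> 0"
    proof (rule AE_I2)
      fix \<mu>
      interpret Q: prob_space "Q n \<mu>" for n by (rule prob)
      have "(\<lambda>n. ennreal (measure (Q (Suc n) \<mu>) (E (Suc n) 0))) \<longlonglongrightarrow> ennreal 0"
        using Q_lim[of \<mu>] by (intro tendsto_ennrealI LIMSEQ_Suc)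
      then show "(\<lambda>n. emeasure (Q (Suc n) \<mu>) (E (Suc n) 0)) \<longlonglongrightarrow> 0"
        by (simp add: Q.emeasure_eq_measure)
    qed
    show "(\<integral>\<^sup>+\<mu>. 1 \<partial>std_normal_distribution) < \<infinity>"
      using Z.emeasure_space_1 by simp
  qed (use Q_meas in auto)
  then have "(\<lambda>n. emeasure (R (Suc n)) (E (Suc n) 0)) \<longlonglongrightarrow> 0"
    by (simp add: mixture)
  then have "(\<lambda>n. measure (R (Suc n)) (E (Suc n) 0)) \<longlonglongrightarrow> 0"
    by (simp add: R.emeasure_eq_measure tendsto_ennreal_iff[of _ _ 0, simplified])
  from tendsto_add[OF this LIMSEQ_Suc[OF R_lim]]
  have "(\<lambda>n. measure (R (Suc n)) (E (Suc n) 0) + measure (R (Suc n)) (E (Suc n) (1/2))) \<longlonglongrightarrow> 0"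
    by simp
  \<comment> \<open>Every estimate is more than \<open>1/5\<close> away from \<open>0\<close> or
    from \<open>1/2\<close>, so the two events cover the space and their probabilities cannot both
    vanish in the limit.\<close>
  moreover have "1 \<le> measure (R (Suc n)) (E (Suc n) 0) + measure (R (Suc n)) (E (Suc n) (1/2))" for n
  proof -
    have sets_R: "sets (R (Suc n)) = sets (?K (Suc n))" by (simp add: R_def)
    have "dist t 0 > 1/5 \<or> dist t (1/2) > 1/5" for t :: real
      unfolding dist_real_def by linarith
    then have "space (R (Suc n)) = E (Suc n) 0 \<union> E (Suc n) (1/2)"
      unfolding sets_eq_imp_space_eq[OF sets_R] by (auto simp: E_def)
    then have "1 = measure (R (Suc n)) (E (Suc n) 0 \<union> E (Suc n) (1/2))"
      using R.prob_space[of "Suc n"] by simp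
    also have "\<dots> \<le> measure (R (Suc n)) (E (Suc n) 0) + measure (R (Suc n)) (E (Suc n) (1/2))"
      by (rule measure_Un_le) (simp_all add: sets_R E_sets)
    finally show ?thesis .
  qed
  ultimately have "1 \<le> (0::real)"
    by (intro tendsto_lowerbound) auto
  then show False by simp
qed

end
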